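(* Let $X$ be a nonempty set and $Y$ a nonempty subset of $X$. Then $\mathcal{D}=\mathcal{J}$ on $\overline{\Omega}(X,Y)$ if and only if $Y$ is finite.
   Context: $T(X)$ is the semigroup of all maps $X\to X$ under composition; maps are written on the right and composed from left to right, so $x(fg)=(xf)g$, and $Yf=\{yf\colon y\in Y\}$. Let $\overline{\Omega}(X,Y)=\{f\in T(X)\colon Yf=Y\}$, a subsemigroup of $T(X)$ containing the identity map. Green's relations on a semigroup $S$ with identity: $(a,b)\in\mathcal{L}$ iff $a=cb$ and $b=da$ for some $c,d\in S$; $(a,b)\in\mathcal{R}$ iff $a=bc$ and $b=ad$ for some $c,d\in S$; $\mathcal{D}=\mathcal{L}\circ\mathcal{R}$; $(a,b)\in\mathcal{J}$ iff $a=cbd$ and $b=c'ad'$ for some $c,d,c',d'\in S$. *)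

theory Defs
  imports "HOL-Algebra.Group"
begin

(* Maps X -> X are represented extensionally (value undefined outside X), so that equality of
   maps is equality on X. Maps act on the right in the source: x(fg) = (xf)g, so the product
   of f and g is "first f, then g". *)

definition full_transf_monoid :: "'a set \<Rightarrow> ('a \<Rightarrow> 'a) monoid" where
  "full_transf_monoid X =
     \<lparr>carrier = X \<rightarrow>\<^sub>E X, mult = (\<lambda>f g. compose X g f), one = (\<lambda>x\<in>X. x)\<rparr>"

definition Omega_bar :: "'a set \<Rightarrow> 'a set \<Rightarrow> ('a \<Rightarrow> 'a) monoid" where
  "Omega_bar X Y =
     (full_transf_monoid X)\<lparr>carrier := {f \<in> carrier (full_transf_monoid X). f ` Y = Y}\<rparr>"

lemma monoid_Omega_bar:
  assumes "Y \<subseteq> X"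
  shows "monoid (Omega_bar X Y)"
proof (rule monoidI)
  fix f g
  assume "f \<in> carrier (Omega_bar X Y)" "g \<in> carrier (Omega_bar X Y)"
  then have *: "f \<in> X \<rightarrow>\<^sub>E X" "g \<in> X \<rightarrow>\<^sub>E X" "f ` Y = Y" "g ` Y = Y"
    by (auto simp: Omega_bar_def full_transf_monoid_def)
  have "compose X g f ` Y = g ` (f ` Y)"
    using assms by (force simp: compose_def image_iff)
  then show "f \<otimes>\<^bsub>Omega_bar X Y\<^esub> g \<in> carrier (Omega_bar X Y)"
    using * by (auto simp: Omega_bar_def full_transf_monoid_def compose_def)
next
  show "\<one>\<^bsub>Omega_bar X Y\<^esub> \<in> carrier (Omega_bar X Y)"
    using assms by (auto simp: Omega_bar_def full_transf_monoid_def image_iff)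
qed (auto simp: Omega_bar_def full_transf_monoid_def compose_def PiE_def Pi_def extensional_def fun_eq_iff)

(* The monoid has an identity, so multipliers range over its carrier and no identity has to be
   adjoined. *)

definition green_L :: "('a, 'b) monoid_scheme \<Rightarrow> 'a rel" where
  "green_L S = {(a, b). a \<in> carrier S \<and> b \<in> carrier S \<and>
     (\<exists>c\<in>carrier S. \<exists>d\<in>carrier S. a = c \<otimes>\<^bsub>S\<^esub> b \<and> b = d \<otimes>\<^bsub>S\<^esub> a)}"

definition green_R :: "('a, 'b) monoid_scheme \<Rightarrow> 'a rel" where
  "green_R S = {(a, b). a \<in> carrier S \<and> b \<in> carrier S \<and>
     (\<exists>c\<in>carrier S. \<exists>d\<in>carrier S. a = b \<otimes>\<^bsub>S\<^esub> c \<and> b = a \<otimes>\<^bsub>S\<^esub> d)}"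

definition green_D :: "('a, 'b) monoid_scheme \<Rightarrow> 'a rel" where
  "green_D S = green_L S O green_R S"

definition green_J :: "('a, 'b) monoid_scheme \<Rightarrow> 'a rel" where
  "green_J S = {(a, b). a \<in> carrier S \<and> b \<in> carrier S \<and>
     (\<exists>c\<in>carrier S. \<exists>d\<in>carrier S. \<exists>c'\<in>carrier S. \<exists>d'\<in>carrier S.
        a = c \<otimes>\<^bsub>S\<^esub> b \<otimes>\<^bsub>S\<^esub> d \<and> b = c' \<otimes>\<^bsub>S\<^esub> a \<otimes>\<^bsub>S\<^esub> d')}"

end

theory Submission
  imports Defs "HOL-Library.Equipollence"
begin

text \<open>
  In any monoid \<open>\<D> \<subseteq> \<J>\<close>, so only the converse inclusion is at stake. Write \<open>S\<close> for the monoid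
  of maps \<open>f : X \<rightarrow> X\<close> with \<open>f ` Y = Y\<close>. Two observations govern divisibility in \<open>S\<close>. Postcomposition
  with elements of \<open>S\<close> is as free as in the full transformation monoid: \<open>a\<close> is \<open>b\<close> followed by some
  element of \<open>S\<close> as soon as the kernel of \<open>b\<close> refines that of \<open>a\<close> (lemma \<open>kernel_imp_left_divides\<close>).
  Precomposition is not: a first factor must cover \<open>Y\<close>, so it can enlarge a fibre over \<open>Y\<close> but never
  shrink one. If \<open>b\<close> is injective on \<open>Y\<close> there is nothing to enlarge, and inclusion of images suffices
  (lemma \<open>image_imp_right_divides\<close>).

  Let \<open>Y\<close> be finite. Every element of \<open>S\<close> permutes \<open>Y\<close>, so only the part of the image outside \<open>Y\<close>
  matters. If \<open>a = c b d\<close>, then every point of \<open>a ` X - Y\<close> is the value under \<open>d\<close> of a point of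
  \<open>b ` X - Y\<close>, because \<open>d\<close> keeps \<open>Y\<close> inside \<open>Y\<close>; so \<open>\<J>\<close>-related maps \<open>a\<close>, \<open>b\<close> have
  equipollent images outside \<open>Y\<close>, by Schroeder-Bernstein. Relabelling the values of \<open>b\<close> along
  such a bijection gives a map with the kernel of \<open>b\<close> and the image of \<open>a\<close>, which links \<open>a\<close> to \<open>b\<close>
  by \<open>\<L>\<close> and then \<open>\<R>\<close>.

  Let \<open>Y\<close> be infinite. The number of non-singleton fibres over points of \<open>Y\<close>, counted inside \<open>Y\<close>,
  is a \<open>\<D>\<close>-invariant; the proof uses only whether it is at least two
  (lemma \<open>collapses_twice_green_D\<close>). It is not a \<open>\<J>\<close>-invariant: let \<open>b\<close> have exactly two
  non-singleton fibres, one of them infinite, and let \<open>a\<close> arise from \<open>b\<close> by merging these two.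
  Conversely \<open>b\<close> arises from \<open>a\<close> by enlarging a singleton fibre; the infinite fibre absorbs the
  points that the merging added to it. This happens on a countable subset of \<open>Y\<close>, and
  everything is the identity elsewhere.
\<close>

section \<open>The monoid and its divisibility relations\<close>

lemma carrier_Omega_bar: "f \<in> carrier (Omega_bar X Y) \<longleftrightarrow> f \<in> X \<rightarrow>\<^sub>E X \<and> f ` Y = Y"
  by (simp add: Omega_bar_def full_transf_monoid_def)

lemma mult_Omega_bar: "f \<otimes>\<^bsub>Omega_bar X Y\<^esub> g = compose X g f"
  by (simp add: Omega_bar_def full_transf_monoid_def)

lemma green_D_subset_green_J:
  assumes "monoid S"
  shows "green_D S \<subseteq> green_J S"
proof (rule subrelI)
  interpret monoid S by fact
  fix a b assume "(a, b) \<in> green_D S"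
  then obtain m where "(a, m) \<in> green_L S" "(m, b) \<in> green_R S"
    by (auto simp: green_D_def)
  then obtain c d e g where S: "a \<in> carrier S" "b \<in> carrier S" "c \<in> carrier S" "d \<in> carrier S"
      "e \<in> carrier S" "g \<in> carrier S"
    and eqs: "a = c \<otimes>\<^bsub>S\<^esub> m" "m = d \<otimes>\<^bsub>S\<^esub> a" "m = b \<otimes>\<^bsub>S\<^esub> e" "b = m \<otimes>\<^bsub>S\<^esub> g"
    unfolding green_L_def green_R_def by blast
  have "a = c \<otimes>\<^bsub>S\<^esub> b \<otimes>\<^bsub>S\<^esub> e"
    using S eqs(1,3) by (simp add: m_assoc)
  moreover have "b = d \<otimes>\<^bsub>S\<^esub> a \<otimes>\<^bsub>S\<^esub> g"
    using eqs(2,4) by simp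
  ultimately show "(a, b) \<in> green_J S"
    using S unfolding green_J_def by blast
qed

text \<open>
  The second factor is forced on the image of \<open>b\<close> and free elsewhere. It covers \<open>Y\<close> automatically,
  because the image of \<open>b\<close> contains \<open>Y = b ` Y\<close>.
\<close>
lemma kernel_imp_left_divides:
  assumes "Y \<subseteq> X" "a \<in> carrier (Omega_bar X Y)" "b \<in> carrier (Omega_bar X Y)"
    and ker: "\<And>x x'. x \<in> X \<Longrightarrow> x' \<in> X \<Longrightarrow> b x = b x' \<Longrightarrow> a x = a x'"
  shows "\<exists>c\<in>carrier (Omega_bar X Y). a = b \<otimes>\<^bsub>Omega_bar X Y\<^esub> c"
proof -
  have a: "a \<in> X \<rightarrow>\<^sub>E X" "a ` Y = Y" and b: "b \<in> X \<rightarrow>\<^sub>E X" "b ` Y = Y"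
    using assms by (auto simp: carrier_Omega_bar)
  define c where "c = (\<lambda>z\<in>X. if z \<in> b ` X then a (inv_into X b z) else z)"
  have cb: "c (b x) = a x" if "x \<in> X" for x
  proof -
    have "b x \<in> X" using that b by auto
    moreover have "a (inv_into X b (b x)) = a x"
      using that by (intro ker) (auto intro: inv_into_into simp: f_inv_into_f)
    ultimately show ?thesis using that by (simp add: c_def)
  qed
  have "c \<in> X \<rightarrow>\<^sub>E X"
    using a by (auto simp: c_def intro!: PiE_mem[OF a(1)] inv_into_into)
  moreover have "c ` Y = Y"
  proof -
    have "c ` Y = (\<lambda>y. c (b y)) ` Y" by (subst b(2)[symmetric]) (simp add: image_image)
    also have "\<dots> = a ` Y" using cb \<open>Y \<subseteq> X\<close> by (intro image_cong) auto
    finally show ?thesis using a by simp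
  qed
  moreover have "a = compose X c b"
    using a(1) cb by (intro extensionalityI[of _ X]) (auto simp: compose_def PiE_iff)
  ultimately show ?thesis by (auto simp: carrier_Omega_bar mult_Omega_bar)
qed

text \<open>
  The first factor sends \<open>x\<close> to a preimage under \<open>b\<close> of \<open>a x\<close>, which must be taken in \<open>Y\<close> when \<open>x\<close>
  is in \<open>Y\<close>. Injectivity of \<open>b\<close> on \<open>Y\<close> makes these preimages in \<open>Y\<close> unique, and this is why they
  exhaust \<open>Y\<close>.
\<close>
lemma image_imp_right_divides:
  assumes "Y \<subseteq> X" "a \<in> carrier (Omega_bar X Y)" "b \<in> carrier (Omega_bar X Y)"
    and img: "a ` X \<subseteq> b ` X" and inj: "inj_on b Y"
  shows "\<exists>c\<in>carrier (Omega_bar X Y). a = c \<otimes>\<^bsub>Omega_bar X Y\<^esub> b"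
proof -
  have a: "a \<in> X \<rightarrow>\<^sub>E X" "a ` Y = Y" and b: "b \<in> X \<rightarrow>\<^sub>E X" "b ` Y = Y"
    using assms by (auto simp: carrier_Omega_bar)
  define c where "c = (\<lambda>x\<in>X. if x \<in> Y then inv_into Y b (a x) else inv_into X b (a x))"
  have aY: "a y \<in> b ` Y" if "y \<in> Y" for y using that a b by auto
  have cX: "c x \<in> X" and bc: "b (c x) = a x" if "x \<in> X" for x
  proof -
    have "a x \<in> b ` X" using that img by auto
    then show "c x \<in> X" "b (c x) = a x"
      using that aY[of x] \<open>Y \<subseteq> X\<close> inv_into_into[of "a x" b X] inv_into_into[of "a x" b Y]
      by (auto simp: c_def f_inv_into_f)
  qed
  have "c ` Y = Y"
  proof -
    have "c ` Y = inv_into Y b ` a ` Y"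
      using \<open>Y \<subseteq> X\<close> by (force simp: c_def image_image intro!: image_cong)
    also have "\<dots> = inv_into Y b ` b ` Y" using a b by simp
    also have "\<dots> = Y" using inj by simp
    finally show ?thesis .
  qed
  moreover have "c \<in> X \<rightarrow>\<^sub>E X"
    using cX by (auto simp: c_def)
  moreover have "a = compose X b c"
    using a(1) bc by (intro extensionalityI[of _ X]) (auto simp: compose_def PiE_iff)
  ultimately show ?thesis by (auto simp: carrier_Omega_bar mult_Omega_bar)
qed

section \<open>Finite distinguished subset\<close>

lemma image_diff_lepoll:
  assumes "Y \<subseteq> X" "b \<in> carrier (Omega_bar X Y)" "c \<in> carrier (Omega_bar X Y)"
      "d \<in> carrier (Omega_bar X Y)"
    and a: "a = c \<otimes>\<^bsub>Omega_bar X Y\<^esub> b \<otimes>\<^bsub>Omega_bar X Y\<^esub> d"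
  shows "a ` X - Y \<lesssim> b ` X - Y"
proof -
  have c: "c \<in> X \<rightarrow>\<^sub>E X" and d: "d ` Y = Y"
    using assms by (auto simp: carrier_Omega_bar)
  have "a ` X - Y \<subseteq> d ` (b ` X - Y)"
  proof
    fix z assume z: "z \<in> a ` X - Y"
    then obtain x where x: "x \<in> X" "z = d (b (c x))"
      by (auto simp: a mult_Omega_bar compose_def)
    have "b (c x) \<notin> Y" using z x d by auto
    then show "z \<in> d ` (b ` X - Y)" using x c by auto
  qed
  then show ?thesis
    by (meson image_lepoll lepoll_trans subset_imp_lepoll)
qed

lemma green_J_subset_green_D_if_finite:
  assumes "Y \<subseteq> X" "finite Y"
  shows "green_J (Omega_bar X Y) \<subseteq> green_D (Omega_bar X Y)"
proof (rule subrelI)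
  let ?S = "Omega_bar X Y"
  fix a b assume "(a, b) \<in> green_J ?S"
  then obtain c d c' d' where S: "a \<in> carrier ?S" "b \<in> carrier ?S" "c \<in> carrier ?S"
      "d \<in> carrier ?S" "c' \<in> carrier ?S" "d' \<in> carrier ?S"
    and eqs: "a = c \<otimes>\<^bsub>?S\<^esub> b \<otimes>\<^bsub>?S\<^esub> d" "b = c' \<otimes>\<^bsub>?S\<^esub> a \<otimes>\<^bsub>?S\<^esub> d'"
    unfolding green_J_def by blast
  have a: "a \<in> X \<rightarrow>\<^sub>E X" "a ` Y = Y" and b: "b \<in> X \<rightarrow>\<^sub>E X" "b ` Y = Y"
    using S by (auto simp: carrier_Omega_bar)
  have "b ` X - Y \<approx> a ` X - Y"
    by (intro lepoll_antisym image_diff_lepoll[OF \<open>Y \<subseteq> X\<close> S(2-4) eqs(1)]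
      image_diff_lepoll[OF \<open>Y \<subseteq> X\<close> S(1,5,6) eqs(2)])
  then obtain h where h: "bij_betw h (b ` X - Y) (a ` X - Y)"
    by (auto simp: eqpoll_def)
  define \<phi> where "\<phi> = (\<lambda>z. if z \<in> Y then z else h z)"
  have Yb: "Y \<subseteq> b ` X" and Ya: "Y \<subseteq> a ` X"
    using a b \<open>Y \<subseteq> X\<close> by blast+
  have \<phi>: "bij_betw \<phi> (b ` X) (a ` X)"
  proof -
    have "bij_betw \<phi> Y Y" by (auto simp: \<phi>_def bij_betw_def inj_on_def)
    moreover have "bij_betw \<phi> (b ` X - Y) (a ` X - Y)"
      using h by (rule bij_betw_cong[THEN iffD1, rotated]) (auto simp: \<phi>_def)
    ultimately have "bij_betw \<phi> (Y \<union> (b ` X - Y)) (Y \<union> (a ` X - Y))"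
      by (rule bij_betw_combine) auto
    then show ?thesis using Ya Yb by (simp add: Un_absorb1)
  qed
  define m where "m = (\<lambda>x\<in>X. \<phi> (b x))"
  have m_img: "m ` X = a ` X"
    using \<phi> by (simp add: m_def bij_betw_def image_image)
  have m_Y: "m y = b y" if "y \<in> Y" for y
    using that b \<open>Y \<subseteq> X\<close> by (auto simp: m_def \<phi>_def)
  have m: "m \<in> carrier ?S"
  proof -
    have "m ` Y = Y" using m_Y b(2) by simp
    moreover have "m x \<in> X" if "x \<in> X" for x
    proof -
      have "m x \<in> a ` X" using that m_img by (metis image_eqI)
      then show ?thesis using a(1) by auto
    qed
    ultimately show ?thesis by (auto simp: carrier_Omega_bar m_def)
  qed
  have ker: "m x = m x' \<longleftrightarrow> b x = b x'" if "x \<in> X" "x' \<in> X" for x x'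
    using that bij_betw_imp_inj_on[OF \<phi>] by (auto simp: m_def inj_on_def)
  have inj: "inj_on f Y" if "f \<in> carrier ?S" for f
    using that \<open>finite Y\<close> by (intro finite_surj_inj) (auto simp: carrier_Omega_bar)
  have "(a, m) \<in> green_L ?S"
    using image_imp_right_divides[OF \<open>Y \<subseteq> X\<close> S(1) m _ inj[OF m]]
      image_imp_right_divides[OF \<open>Y \<subseteq> X\<close> m S(1) _ inj[OF S(1)]] S(1) m m_img
    by (auto simp: green_L_def)
  moreover have "(m, b) \<in> green_R ?S"
    using kernel_imp_left_divides[OF \<open>Y \<subseteq> X\<close> m S(2)] kernel_imp_left_divides[OF \<open>Y \<subseteq> X\<close> S(2) m]
      S(2) m ker
    by (auto simp: green_R_def)
  ultimately show "(a, b) \<in> green_D ?S"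
    by (auto simp: green_D_def)
qed

section \<open>Infinite distinguished subset\<close>

definition collapses_twice :: "'a set \<Rightarrow> ('a \<Rightarrow> 'b) \<Rightarrow> bool" where
  "collapses_twice Y f \<longleftrightarrow>
     (\<exists>p\<in>Y. \<exists>q\<in>Y. \<exists>r\<in>Y. \<exists>s\<in>Y. p \<noteq> q \<and> r \<noteq> s \<and> f p = f q \<and> f r = f s \<and> f p \<noteq> f r)"

text \<open>
  Going from \<open>b\<close> to an \<open>\<R>\<close>-related map keeps the kernel, and going on to an \<open>\<L>\<close>-related map
  precomposes with a map that covers \<open>Y\<close>, along which the four witnesses can be pulled back.
\<close>
lemma collapses_twice_green_D:
  assumes "Y \<subseteq> X" "(a, b) \<in> green_D (Omega_bar X Y)" "collapses_twice Y b"
  shows "collapses_twice Y a"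
proof -
  obtain m where "(a, m) \<in> green_L (Omega_bar X Y)" "(m, b) \<in> green_R (Omega_bar X Y)"
    using assms(2) by (auto simp: green_D_def)
  obtain c where "c \<in> carrier (Omega_bar X Y)" and a: "a = compose X m c"
    using \<open>(a, m) \<in> _\<close> unfolding green_L_def mult_Omega_bar by blast
  then have c: "c ` Y = Y" by (simp add: carrier_Omega_bar)
  obtain e where m: "m = compose X e b"
    using \<open>(m, b) \<in> _\<close> unfolding green_R_def mult_Omega_bar by blast
  obtain g where b: "b = compose X g m"
    using \<open>(m, b) \<in> _\<close> unfolding green_R_def mult_Omega_bar by blast
  have ac: "a y = m (c y)" if "y \<in> Y" for y
    using that \<open>Y \<subseteq> X\<close> by (subst a) (auto simp: compose_def)
  have ker: "m y = m y' \<longleftrightarrow> b y = b y'" if "y \<in> Y" "y' \<in> Y" for y y'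
  proof -
    have "m y = e (b y)" "m y' = e (b y')" "b y = g (m y)" "b y' = g (m y')"
      using that \<open>Y \<subseteq> X\<close> m b compose_eq[of _ X e b] compose_eq[of _ X g m] by auto
    then show ?thesis by metis
  qed
  obtain p q r s where Y: "p \<in> Y" "q \<in> Y" "r \<in> Y" "s \<in> Y"
    and pqrs: "p \<noteq> q" "r \<noteq> s" "b p = b q" "b r = b s" "b p \<noteq> b r"
    using assms(3) by (auto simp: collapses_twice_def)
  have pre: "\<exists>y'\<in>Y. c y' = y" if "y \<in> Y" for y
  proof -
    have "y \<in> c ` Y" using that c by simp
    then show ?thesis by auto
  qed
  obtain p' q' r' s' where Y': "p' \<in> Y" "q' \<in> Y" "r' \<in> Y" "s' \<in> Y"
    and c': "c p' = p" "c q' = q" "c r' = r" "c s' = s"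
    using Y[THEN pre] by blast
  have "p' \<noteq> q'" "r' \<noteq> s'" "a p' = a q'" "a r' = a s'" "a p' \<noteq> a r'"
    using pqrs c' ac Y Y' ker by auto
  then show ?thesis using Y' unfolding collapses_twice_def by blast
qed

definition lift_nat_map :: "'a set \<Rightarrow> (nat \<Rightarrow> 'a) \<Rightarrow> (nat \<Rightarrow> nat) \<Rightarrow> 'a \<Rightarrow> 'a" where
  "lift_nat_map X e f = (\<lambda>x\<in>X. if x \<in> range e then e (f (inv_into UNIV e x)) else x)"

context
  fixes X Y :: "'a set" and e :: "nat \<Rightarrow> 'a"
  assumes YX: "Y \<subseteq> X" and inj_e: "inj e" and range_e: "range e \<subseteq> Y"
begin

lemma lift_nat_map_range: "lift_nat_map X e f (e n) = e (f n)"
  using YX inj_e range_e by (auto simp: lift_nat_map_def)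

lemma lift_nat_map_outside: "x \<in> X \<Longrightarrow> x \<notin> range e \<Longrightarrow> lift_nat_map X e f x = x"
  by (simp add: lift_nat_map_def)

lemma lift_nat_map_carrier:
  assumes "surj f"
  shows "lift_nat_map X e f \<in> carrier (Omega_bar X Y)"
proof -
  let ?F = "lift_nat_map X e f"
  have "?F x \<in> X \<and> (x \<in> Y \<longrightarrow> ?F x \<in> Y)" if "x \<in> X" for x
    using that YX range_e by (auto simp: lift_nat_map_def)
  moreover have "y \<in> ?F ` Y" if "y \<in> Y" for y
  proof (cases "y \<in> range e")
    case True
    then obtain n where "y = e (f n)" using assms by (metis imageE surjD)
    then show ?thesis using lift_nat_map_range range_e by (metis image_eqI range_subsetD)
  next
    case False
    then show ?thesis using that YX lift_nat_map_outside by (metis image_eqI subsetD)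
  qed
  moreover have "?F \<in> extensional X"
    by (simp add: lift_nat_map_def)
  ultimately show ?thesis
    using YX unfolding carrier_Omega_bar PiE_iff by blast
qed

lemma lift_nat_map_comp:
  "lift_nat_map X e f \<otimes>\<^bsub>Omega_bar X Y\<^esub> lift_nat_map X e g = lift_nat_map X e (g \<circ> f)"
  unfolding mult_Omega_bar
proof
  fix x show "compose X (lift_nat_map X e g) (lift_nat_map X e f) x = lift_nat_map X e (g \<circ> f) x"
  proof (cases "x \<in> range e")
    case True
    then show ?thesis using YX range_e by (auto simp: compose_def lift_nat_map_range)
  next
    case False
    then show ?thesis
      by (cases "x \<in> X") (auto simp: compose_def lift_nat_map_outside, simp add: lift_nat_map_def)
  qed
qed

end

text \<open>
  The map \<open>b\<close> below sends all even numbers to \<open>0\<close>, sends \<open>1\<close> and \<open>3\<close> to \<open>1\<close>, and is injective on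
  the remaining numbers; \<open>a\<close> is \<open>b\<close> followed by the predecessor map, which merges the fibres over
  \<open>0\<close> and \<open>1\<close> and so leaves a single collapse.
\<close>
lemma green_D_neq_green_J_if_infinite:
  assumes "Y \<subseteq> X" "infinite Y"
  shows "green_D (Omega_bar X Y) \<noteq> green_J (Omega_bar X Y)"
proof
  let ?S = "Omega_bar X Y"
  assume eq: "green_D ?S = green_J ?S"
  obtain e :: "nat \<Rightarrow> 'a" where e: "inj e" "range e \<subseteq> Y"
    using infinite_countable_subset[OF \<open>infinite Y\<close>] by auto
  note ctx = \<open>Y \<subseteq> X\<close> e
  define b :: "nat \<Rightarrow> nat" where "b = (\<lambda>n. if even n then 0 else max 1 (n div 2))"
  define d :: "nat \<Rightarrow> nat" where "d = (\<lambda>n. n - 1)"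
  define a where "a = d \<circ> b"
  \<comment> \<open>The even numbers, which form the infinite fibre of \<open>b\<close>, are spread over the fibre of \<open>a\<close> at
    \<open>0\<close>, which has the extra points \<open>1\<close> and \<open>3\<close>; both \<open>1\<close> and \<open>3\<close> go to \<open>5\<close>, the only point of the
    fibre of \<open>a\<close> at \<open>1\<close>; and the fibre of \<open>b\<close> at \<open>k \<ge> 2\<close> goes to the fibre of \<open>a\<close> at \<open>k\<close>.\<close>
  define c :: "nat \<Rightarrow> nat" where
    "c = (\<lambda>n. if n = 0 then 1 else if n = 2 then 3 else if even n then n - 4 else max 5 (n + 2))"
  have "b (if n = 0 then 0 else 2 * n + 1) = n" for n by (auto simp: b_def)
  then have "surj b" by (rule surjI)
  have "d (Suc n) = n" for n by (simp add: d_def)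
  then have "surj d" by (rule surjI)
  have "n \<in> range c" for n
  proof -
    consider "even n" | "n = 1" | "n = 3" | k where "n = 2 * k + 5"
    proof (cases "odd n \<and> 5 \<le> n")
      case True
      then have "even (n - 5)" by simp
      then obtain k where "n - 5 = 2 * k" by (rule evenE)
      then have "n = 2 * k + 5" using True by linarith
      then show ?thesis by (rule that(4))
    next
      case False
      then have "even n \<or> n = 1 \<or> n = 3" by presburger
      then show ?thesis using that(1-3) by blast
    qed
    then show ?thesis
    proof cases
      case 1
      then have "c (n + 4) = n" by (simp add: c_def)
      then show ?thesis by (metis rangeI)
    next
      case 2
      then have "c 0 = n" by (simp add: c_def)
      then show ?thesis by (metis rangeI)
    next
      case 3
      then have "c 2 = n" by (simp add: c_def)
      then show ?thesis by (metis rangeI)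
    next
      case 4
      then have "c (2 * k + 3) = n" by (simp add: c_def)
      then show ?thesis by (metis rangeI)
    qed
  qed
  then have "surj c" by blast
  have "surj a" using \<open>surj b\<close> \<open>surj d\<close> unfolding a_def by (intro comp_surj)
  have ac: "a \<circ> c = b"
  proof
    fix n show "(a \<circ> c) n = b n"
    proof (cases "even n")
      case False
      then obtain k where "n = 2 * k + 1" by (rule oddE)
      then show ?thesis by (cases "k = 0") (auto simp: a_def b_def c_def d_def max_def)
    qed (auto simp: a_def b_def c_def d_def)
  qed
  let ?L = "lift_nat_map X e"
  have one: "?L id \<in> carrier ?S" by (intro lift_nat_map_carrier[OF ctx]) simp
  have carr: "?L a \<in> carrier ?S" "?L b \<in> carrier ?S" "?L c \<in> carrier ?S" "?L d \<in> carrier ?S"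
    using \<open>surj a\<close> \<open>surj b\<close> \<open>surj c\<close> \<open>surj d\<close> by (auto intro: lift_nat_map_carrier[OF ctx])
  have "?L a = ?L id \<otimes>\<^bsub>?S\<^esub> ?L b \<otimes>\<^bsub>?S\<^esub> ?L d"
    by (simp add: lift_nat_map_comp[OF ctx] a_def)
  moreover have "?L b = ?L c \<otimes>\<^bsub>?S\<^esub> ?L a \<otimes>\<^bsub>?S\<^esub> ?L id"
    by (simp add: lift_nat_map_comp[OF ctx] ac)
  ultimately have "(?L a, ?L b) \<in> green_J ?S"
    using carr one unfolding green_J_def by blast
  moreover have "collapses_twice Y (?L b)"
  proof -
    have "?L b (e 0) = e 0" "?L b (e 2) = e 0" "?L b (e 1) = e 1" "?L b (e 3) = e 1"
      by (simp_all add: lift_nat_map_range[OF ctx] b_def)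
    moreover have "e 0 \<noteq> e 2" "e 1 \<noteq> e 3" "e 0 \<noteq> e 1" using e(1) by (auto simp: inj_eq)
    moreover have "e n \<in> Y" for n using e(2) by auto
    ultimately show ?thesis unfolding collapses_twice_def by metis
  qed
  ultimately have "collapses_twice Y (?L a)"
    using eq collapses_twice_green_D[OF \<open>Y \<subseteq> X\<close>] by blast
  moreover have "?L a p = e 0" if pq: "p \<in> Y" "q \<in> Y" "p \<noteq> q" "?L a p = ?L a q" for p q
  proof -
    have a0: "a i = 0" if "a i = a j" "i \<noteq> j" for i j
    proof (rule ccontr)
      assume "a i \<noteq> 0"
      then have "odd i" "odd j" "i div 2 = j div 2"
        using that(1) by (auto simp: a_def b_def d_def split: if_splits)
      then show False using \<open>i \<noteq> j\<close> by (metis odd_two_times_div_two_succ)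
    qed
    have X: "p \<in> X" "q \<in> X" using pq \<open>Y \<subseteq> X\<close> by auto
    have "?L a x \<in> range e \<longleftrightarrow> x \<in> range e" if "x \<in> X" for x
      using that by (cases "x \<in> range e")
        (auto simp: lift_nat_map_range[OF ctx] lift_nat_map_outside[OF ctx])
    then have same: "p \<in> range e \<longleftrightarrow> q \<in> range e"
      using X pq(4) by metis
    then have "p \<in> range e"
      using X pq(3,4) lift_nat_map_outside[OF ctx, of p a] lift_nat_map_outside[OF ctx, of q a]
      by auto
    with same obtain i j where ij: "p = e i" "q = e j" by auto
    then have "a i = a j" "i \<noteq> j"
      using pq e(1) by (auto simp: lift_nat_map_range[OF ctx] inj_eq)
    then have "a i = 0" by (rule a0)
    then show ?thesis using ij by (simp add: lift_nat_map_range[OF ctx])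
  qed
  ultimately show False unfolding collapses_twice_def by metis
qed

theorem theorem4p12:
  fixes X Y :: "'a set"
  assumes "X \<noteq> {}" and "Y \<noteq> {}" and "Y \<subseteq> X"
  shows "green_D (Omega_bar X Y) = green_J (Omega_bar X Y) \<longleftrightarrow> finite Y"
proof
  show "finite Y" if "green_D (Omega_bar X Y) = green_J (Omega_bar X Y)"
    using that green_D_neq_green_J_if_infinite[OF \<open>Y \<subseteq> X\<close>] by blast
  show "green_D (Omega_bar X Y) = green_J (Omega_bar X Y)" if "finite Y"
    using green_D_subset_green_J[OF monoid_Omega_bar[OF \<open>Y \<subseteq> X\<close>]]
      green_J_subset_green_D_if_finite[OF \<open>Y \<subseteq> X\<close> that] by blast
qed

end
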